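(* For $j\geq 0$ let $t_j=(4^j-1)/3$ (so that for $j\ge1$ the binary representation of $t_j$ is $(10)^{j-1}1$, i.e. the block $10$ repeated $j-1$ times followed by $1$). Then, as $j\to\infty$, \[ c_{t_j}=\frac 12+\frac{\sqrt{3}}{4\sqrt{2\pi j} }+O\bigl(j^{-3/2}\bigr). \] Moreover, $c_{t_j} > \frac 12$ holds for all $j\ge 1$.
   Context: For a nonnegative integer $n$, $s(n)$ denotes the binary sum of digits of $n$. For an integer $t\ge 0$, $c_t$ is the asymptotic density of the set $\{n\ge 0: s(n+t)\ge s(n)\}$ (this density exists). *)

theory Defs
  imports Complex_Main "HOL-Library.Landau_Symbols"
begin

fun bin_digit_sum :: "nat \<Rightarrow> nat" where
  "bin_digit_sum n = (if n = 0 then 0 else n mod 2 + bin_digit_sum (n div 2))"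

declare bin_digit_sum.simps[simp del]

text \<open>c_t: asymptotic density of {n \<ge> 0. s(n+t) \<ge> s(n)} (the limit exists by the paper).\<close>
definition cdens :: "nat \<Rightarrow> real" where
  "cdens t = lim (\<lambda>N. real (card {n. n < N \<and> bin_digit_sum (n + t) \<ge> bin_digit_sum n}) / real N)"

definition tj :: "nat \<Rightarrow> nat" where
  "tj j = (4 ^ j - 1) div 3"

end

theory Submission
  imports Defs "HOL-Analysis.Analysis" "HOL-Real_Asymp.Real_Asymp"
begin

text \<open>
  Let a(j,k) be the density of the n with s(n + t_j) \<ge> s(n) + k. Splitting n by parity gives
  a(j+2,k) = (a(j+1,k-1) + a(j+1,k+1)) / 2 + a(j+1,k) / 4 - a(j,k) / 4, a recursion that is
  symmetric in k. The symmetrization f(j,k) = a(j,k) + a(j,-k) - 1, whose value at k = 0 is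
  2 c - 1, therefore satisfies it as well.

  Positivity: f(j,k) = F(j,k+1) - F(j,k-1) for an odd solution F of the same recursion, so
  c - 1/2 = F(j,1). For odd solutions the recursion lives on k \<ge> 1, where it splits into two
  steps with nonnegative coefficients, and the initial data of F are positive there.

  Asymptotics: f(j,0) is the mean over [0,pi] of a symbol that satisfies a linear recursion with
  characteristic roots l and 1/(4 l), where l + 1/(4 l) = cos t + 1/4. Where the roots are complex
  the symbol is exponentially small. Elsewhere the substitution l = (cos p)^2 turns the integral
  into a Wallis integral of order 2 j - 1 with a Lipschitz factor.
\<close>

section \<open>Densities\<close>

definition has_density :: "nat set \<Rightarrow> real \<Rightarrow> bool" where
  "has_density A d \<longleftrightarrow> (\<lambda>N. real (card {n. n < N \<and> n \<in> A}) / real N) \<longlonglongrightarrow> d"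

lemma card_below_parity:
  fixes N :: nat
  shows "card {n. n < N \<and> n \<in> A} =
     card {m. m < (N + 1) div 2 \<and> 2 * m \<in> A} + card {m. m < N div 2 \<and> 2 * m + 1 \<in> A}"
proof -
  let ?E = "{m. m < (N + 1) div 2 \<and> 2 * m \<in> A}" and ?O = "{m. m < N div 2 \<and> 2 * m + 1 \<in> A}"
  have "{n. n < N \<and> n \<in> A} = (\<lambda>m. 2 * m) ` ?E \<union> (\<lambda>m. 2 * m + 1) ` ?O"
  proof (intro equalityI subsetI)
    fix n assume n: "n \<in> {n. n < N \<and> n \<in> A}"
    show "n \<in> (\<lambda>m. 2 * m) ` ?E \<union> (\<lambda>m. 2 * m + 1) ` ?O"
    proof (cases "even n")
      case True
      then obtain m where "n = 2 * m" by blast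
      with n show ?thesis by auto
    next
      case False
      then obtain m where "n = 2 * m + 1" by (rule oddE)
      with n show ?thesis by auto
    qed
  qed auto
  moreover have "card ((\<lambda>m. 2 * m) ` ?E \<union> (\<lambda>m. 2 * m + 1) ` ?O) =
      card ((\<lambda>m. 2 * m) ` ?E) + card ((\<lambda>m. 2 * m + 1) ` ?O)"
    by (rule card_Un_disjoint) (auto, presburger)
  ultimately show ?thesis by (simp add: card_image inj_on_def)
qed

lemma has_density_parity:
  assumes "has_density {m. 2 * m \<in> A} a" and "has_density {m. 2 * m + 1 \<in> A} b"
  shows "has_density A ((a + b) / 2)"
proof -
  define E where "E M = real (card {m. m < M \<and> 2 * m \<in> A})" for M
  define D where "D M = real (card {m. m < M \<and> 2 * m + 1 \<in> A})" for M
  have lim: "(\<lambda>M. E M / real M) \<longlonglongrightarrow> a" "(\<lambda>M. D M / real M) \<longlonglongrightarrow> b"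
    using assms by (simp_all add: has_density_def E_def D_def)
  \<comment> \<open>\<open>e = 1\<close> gives the number of even and \<open>e = 0\<close> the
    number of odd integers below \<open>N\<close>; both differ from N/2 by at most 1/2.\<close>
  have half: "(\<lambda>N. real ((N + e) div 2) / real N) \<longlonglongrightarrow> 1 / 2" if "e \<le> 1" for e :: nat
  proof (rule LIMSEQ_I)
    fix r :: real assume r: "r > 0"
    obtain M where M: "1 / r < real M" using reals_Archimedean2 by blast
    have "norm (real ((N + e) div 2) / real N - 1 / 2) < r" if "N \<ge> M + 1" for N
    proof -
      have "2 * real ((N + e) div 2) \<le> real N + 1" "2 * real ((N + e) div 2) \<ge> real N - 1"
        using \<open>e \<le> 1\<close> by linarith+
      then have "norm (real ((N + e) div 2) / real N - 1 / 2) \<le> 1 / real N"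
        using that by (auto simp: field_simps abs_le_iff)
      also have "\<dots> < r"
      proof -
        have "1 < r * real M" using M r by (simp add: field_simps)
        also have "\<dots> \<le> r * real N" using that r by (intro mult_left_mono) auto
        finally show ?thesis using that by (simp add: field_simps)
      qed
      finally show ?thesis .
    qed
    then show "\<exists>no. \<forall>N\<ge>no. norm (real ((N + e) div 2) / real N - 1 / 2) < r" by blast
  qed
  have tends: "filterlim (\<lambda>N. (N + e) div 2) at_top sequentially" for e :: nat
    unfolding filterlim_at_top
  proof
    fix Z :: nat
    show "\<forall>\<^sub>F N in sequentially. Z \<le> (N + e) div 2"
      using eventually_ge_at_top[of "2 * Z"] by eventually_elim linarith
  qed
  have lim2: "(\<lambda>N. E ((N + 1) div 2) / real ((N + 1) div 2)) \<longlonglongrightarrow> a"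
    "(\<lambda>N. D ((N + 0) div 2) / real ((N + 0) div 2)) \<longlonglongrightarrow> b"
    using filterlim_compose[OF lim(1) tends[of 1]] filterlim_compose[OF lim(2) tends[of 0]] by simp_all
  have "(\<lambda>N. E ((N + 1) div 2) / real ((N + 1) div 2) * (real ((N + 1) div 2) / real N) +
      D ((N + 0) div 2) / real ((N + 0) div 2) * (real ((N + 0) div 2) / real N))
      \<longlonglongrightarrow> a * (1 / 2) + b * (1 / 2)"
    by (intro tendsto_add tendsto_mult half lim2) auto
  \<comment> \<open>This holds at \<open>M = 0\<close> as well, because the counts vanish
    there.\<close>
  moreover have cancel: "E M / real M * (real M / x) = E M / x" "D M / real M * (real M / x) = D M / x" for M x
    by (cases "M = 0"; simp add: E_def D_def)+
  ultimately have "(\<lambda>N. E ((N + 1) div 2) / real N + D (N div 2) / real N) \<longlonglongrightarrow> (a + b) / 2"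
    unfolding cancel by (simp only: add_0_right add_divide_distrib mult_1_right times_divide_eq_right)
  then show ?thesis
    unfolding has_density_def card_below_parity E_def D_def by (simp add: add_divide_distrib)
qed

lemma has_density_empty: "has_density {} 0"
  by (simp add: has_density_def)

lemma has_density_UNIV: "has_density UNIV 1"
  unfolding has_density_def by (rule Lim_transform_eventually[OF tendsto_const])
    (use eventually_gt_at_top[of 0] in eventually_elim, simp)

section \<open>Digit sums and gain sets under doubling\<close>

lemma bin_digit_sum_double [simp]: "bin_digit_sum (2 * n) = bin_digit_sum n"
  by (cases "n = 0") (simp_all add: bin_digit_sum.simps[of "2 * n"])

lemma bin_digit_sum_Suc_double [simp]: "bin_digit_sum (Suc (2 * n)) = Suc (bin_digit_sum n)"
  by (simp add: bin_digit_sum.simps[of "Suc (2 * n)"])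

lemma bin_digit_sum_Suc_le: "bin_digit_sum (Suc n) \<le> Suc (bin_digit_sum n)"
proof (induction n rule: less_induct)
  case (less n)
  show ?case
  proof (cases "even n")
    case True
    then show ?thesis by (auto elim!: evenE)
  next
    case False
    then obtain m where m: "n = Suc (2 * m)" by (auto elim: oddE)
    then have "Suc n = 2 * Suc m" by simp
    then have "bin_digit_sum (Suc n) = bin_digit_sum (Suc m)" by (simp only: bin_digit_sum_double)
    also have "\<dots> \<le> Suc (bin_digit_sum m)" using less.IH m by simp
    finally show ?thesis using m by simp
  qed
qed

definition gain_set :: "nat \<Rightarrow> int \<Rightarrow> nat set" where
  "gain_set t k = {n. int (bin_digit_sum (n + t)) \<ge> int (bin_digit_sum n) + k}"

text \<open>Adding an even number leaves the last bit of n alone, so each parity class of n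
  reproduces the set for \<open>t\<close>.\<close>

lemma gain_set_double:
  assumes "has_density (gain_set t k) d"
  shows "has_density (gain_set (2 * t) k) d"
proof -
  have "bin_digit_sum (2 * m + 2 * t) = bin_digit_sum (m + t)"
    "bin_digit_sum (Suc (2 * m + 2 * t)) = Suc (bin_digit_sum (m + t))" for m
    using bin_digit_sum_double[of "m + t"] bin_digit_sum_Suc_double[of "m + t"]
    by (simp_all add: distrib_left del: bin_digit_sum_double bin_digit_sum_Suc_double)
  then have "{m. 2 * m \<in> gain_set (2 * t) k} = gain_set t k"
    "{m. 2 * m + 1 \<in> gain_set (2 * t) k} = gain_set t k"
    by (simp_all add: gain_set_def)
  with assms have "has_density (gain_set (2 * t) k) ((d + d) / 2)"
    by (intro has_density_parity) simp_all
  then show ?thesis by simp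
qed

text \<open>For n = 2m the sum acquires a final 1, which lowers the threshold for m by one. For n =
  2m + 1 the final 1 is lost and a carry turns \<open>t\<close> into \<open>t + 1\<close>, which
  raises the threshold by one.\<close>

lemma gain_set_Suc_double:
  assumes "has_density (gain_set t (k - 1)) d" and "has_density (gain_set (t + 1) (k + 1)) e"
  shows "has_density (gain_set (2 * t + 1) k) ((d + e) / 2)"
proof -
  have "bin_digit_sum (Suc (2 * m + 2 * t)) = Suc (bin_digit_sum (m + t))"
    "bin_digit_sum (Suc (Suc (2 * m + 2 * t))) = bin_digit_sum (Suc (m + t))" for m
    using bin_digit_sum_double[of "Suc (m + t)"] bin_digit_sum_Suc_double[of "m + t"]
    by (simp_all add: distrib_left del: bin_digit_sum_double bin_digit_sum_Suc_double)
  then have "{m. 2 * m \<in> gain_set (2 * t + 1) k} = gain_set t (k - 1)"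
    "{m. 2 * m + 1 \<in> gain_set (2 * t + 1) k} = gain_set (t + 1) (k + 1)"
    by (auto simp add: gain_set_def)
  with assms show ?thesis
    by (intro has_density_parity) simp_all
qed

lemma gain_set_0: "has_density (gain_set 0 k) (if k \<le> 0 then 1 else 0)"
  using has_density_UNIV has_density_empty by (simp add: gain_set_def)

lemma gain_set_1_empty:
  assumes "k \<ge> 2"
  shows "gain_set 1 k = {}"
proof -
  have "\<not> int (bin_digit_sum n) + k \<le> int (bin_digit_sum (Suc n))" for n
    using bin_digit_sum_Suc_le[of n] assms by linarith
  then show ?thesis by (simp add: gain_set_def)
qed

text \<open>The gain s(n + 1) - s(n) is 1 minus the number of trailing ones of n, which is
  geometrically distributed. The proof descends from \<open>k = 2\<close>: since 1 = 2 * 0 + 1, the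
  value at \<open>i - 1\<close> is the mean of 1 and the value at \<open>i\<close>.\<close>

lemma gain_set_1: "has_density (gain_set 1 k) (1 - (1/2) ^ nat (2 - k))"
proof (cases "k \<ge> 2")
  case True
  then show ?thesis using has_density_empty gain_set_1_empty by simp
next
  case False
  then have "k \<le> 2" by simp
  then show ?thesis
  proof (induction k rule: int_le_induct)
    case base
    show ?case using has_density_empty gain_set_1_empty by simp
  next
    case (step i)
    have "has_density (gain_set (2 * 0 + 1) (i - 1)) ((1 + (1 - (1/2) ^ nat (2 - i))) / 2)"
    proof (rule gain_set_Suc_double)
      show "has_density (gain_set 0 (i - 1 - 1)) 1"
        using gain_set_0[of "i - 2"] step.hyps by simp
      show "has_density (gain_set (0 + 1) (i - 1 + 1)) (1 - (1/2) ^ nat (2 - i))"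
        using step.IH by simp
    qed
    moreover have "nat (2 - (i - 1)) = Suc (nat (2 - i))" using step.hyps by simp
    ultimately show ?case by (simp add: field_simps)
  qed
qed

section \<open>The densities for \<open>tj j\<close>\<close>

lemma tj_0 [simp]: "tj 0 = 0" by (simp add: tj_def)

lemma tj_Suc: "tj (Suc j) = 2 * (2 * tj j) + 1"
proof -
  \<comment> \<open>This makes the division by 3 in \<open>tj\<close> exact.\<close>
  have "\<exists>q. (4::nat) ^ j = 3 * q + 1"
  proof (induction j)
    case (Suc j)
    then obtain q where "(4::nat) ^ j = 3 * q + 1" by blast
    then have "(4::nat) ^ Suc j = 3 * (4 * q + 1) + 1" by simp
    then show ?case by blast
  qed simp
  then obtain q where "(4::nat) ^ j = 3 * q + 1" by blast
  then show ?thesis by (simp add: tj_def)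
qed

text \<open>The recursion is kept apart from its initial data because \<open>gain_density\<close>
  and \<open>half_chain\<close> share it.\<close>

fun chain :: "(int \<Rightarrow> real) \<Rightarrow> (int \<Rightarrow> real) \<Rightarrow> nat \<Rightarrow> int \<Rightarrow> real" where
  "chain u v 0 k = u k"
| "chain u v (Suc 0) k = v k"
| "chain u v (Suc (Suc j)) k =
     (chain u v (Suc j) (k - 1) + chain u v (Suc j) (k + 1)) / 2 + chain u v (Suc j) k / 4
     - chain u v j k / 4"

definition gain_density :: "nat \<Rightarrow> int \<Rightarrow> real" where
  "gain_density = chain (\<lambda>k. if k \<le> 0 then 1 else 0) (\<lambda>k. 1 - (1/2) ^ nat (2 - k))"

lemma gain_density_rec:
  "gain_density (Suc (Suc j)) k =
     (gain_density (Suc j) (k - 1) + gain_density (Suc j) (k + 1)) / 2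
     + gain_density (Suc j) k / 4 - gain_density j k / 4"
  by (simp add: gain_density_def)

(* The second conjunct is the recursion for t_(j+1) = 4 t_j + 1 solved for the density at t_j + 1. *)
lemma gain_set_tj:
  "has_density (gain_set (tj j) k) (gain_density j k) \<and>
   has_density (gain_set (tj j + 1) k)
     (4 * gain_density (Suc j) (k - 2) - 2 * gain_density j (k - 3) - gain_density j (k - 2))"
proof (induction j arbitrary: k)
  case 0
  have "4 * gain_density (Suc 0) (k - 2) - 2 * gain_density 0 (k - 3) - gain_density 0 (k - 2)
      = 1 - (1/2) ^ nat (2 - k)"
  proof (cases "k \<le> 2")
    case True
    then have "nat (2 - (k - 2)) = Suc (Suc (nat (2 - k)))" by simp
    then have "(1/2::real) ^ nat (2 - (k - 2)) = (1/2) ^ nat (2 - k) / 4" by (simp only: power_Suc)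
    then show ?thesis using True by (simp add: gain_density_def)
  next
    case False
    \<comment> \<open>At \<open>k = 3\<close> the term \<open>gain_density 0 (k - 3)\<close> is
      still 1 and cancels against \<open>4 * gain_density (Suc 0) 1 = 2\<close>; beyond that every
      term is 0.\<close>
    then consider "k = 3" | "k \<ge> 4" by linarith
    then show ?thesis by cases (simp_all add: gain_density_def)
  qed
  moreover have "gain_density 0 k = (if k \<le> 0 then 1 else 0)" by (simp add: gain_density_def)
  ultimately show ?case using gain_set_0[of k] gain_set_1[of k] by (simp del: of_nat_Suc)
next
  case (Suc j)
  let ?a = gain_density
  have even: "has_density (gain_set (2 * tj j) i) (?a j i)" for i
    using Suc.IH gain_set_double by blast
  \<comment> \<open>The shift \<open>2 * tj j + 1\<close> serves twice: paired with
    \<open>2 * tj j\<close> it yields t_(j+1) = 4 t_j + 1, and doubled it yields t_(j+1) +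
    1.\<close>
  have odd: "has_density (gain_set (2 * tj j + 1) i) (2 * ?a (Suc j) (i - 1) - ?a j (i - 2))" for i
    using gain_set_Suc_double[of "tj j" i "?a j (i - 1)"
        "4 * ?a (Suc j) (i - 1) - 2 * ?a j (i - 2) - ?a j (i - 1)"]
      conjunct1[OF Suc.IH[of "i - 1"]] conjunct2[OF Suc.IH[of "i + 1"]]
    by (simp add: algebra_simps diff_divide_distrib)
  have "has_density (gain_set (2 * (2 * tj j) + 1) k) (?a (Suc j) k)"
    using gain_set_Suc_double[OF even odd, of k] by simp
  moreover have "has_density (gain_set (2 * (2 * tj j + 1)) k)
      (4 * ?a (Suc (Suc j)) (k - 2) - 2 * ?a (Suc j) (k - 3) - ?a (Suc j) (k - 2))"
    using gain_set_double[OF odd[of k]] by (simp add: gain_density_rec algebra_simps add_divide_distrib)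
  ultimately show ?case by (simp add: tj_Suc algebra_simps)
qed

lemma cdens_tj: "cdens (tj j) = gain_density j 0"
  using limI[OF conjunct1[OF gain_set_tj[of j 0], unfolded has_density_def]]
  by (simp add: cdens_def gain_set_def)

section \<open>Positivity\<close>

text \<open>This is the odd solution F of the overview. A difference over distance 2 treats even and
  odd indices separately: the geometric part 2^(-k)/6 matches the tail of the symmetrized density at
  level 1, and oddness then fixes the constants, 1/6 from \<open>k = 0\<close> and 1/3 from
  \<open>k = 1\<close>.\<close>

definition half_chain :: "nat \<Rightarrow> int \<Rightarrow> real" where
  "half_chain = chain (\<lambda>k. if odd k then of_int (sgn k) / 2 else 0)
     (\<lambda>k. of_int (sgn k) * ((if odd k then 1/6 else 1/3) + (1/2) ^ nat \<bar>k\<bar> / 6))"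

lemma half_chain_rec:
  "half_chain (Suc (Suc j)) k =
     (half_chain (Suc j) (k - 1) + half_chain (Suc j) (k + 1)) / 2
     + half_chain (Suc j) k / 4 - half_chain j k / 4"
  by (simp add: half_chain_def)

lemma half_chain_minus: "half_chain j (- k) = - half_chain j k"
proof (induction j arbitrary: k rule: induct_nat_012)
  case (ge2 j)
  have "half_chain (Suc j) (- k - 1) = - half_chain (Suc j) (k + 1)"
    "half_chain (Suc j) (- k + 1) = - half_chain (Suc j) (k - 1)"
    using ge2(2)[of "k + 1"] ge2(2)[of "k - 1"] by simp_all
  with ge2 show ?case by (simp add: half_chain_rec field_simps)
qed (simp_all add: half_chain_def sgn_if)

text \<open>Both sides are even in \<open>k\<close>, so nonnegative \<open>k\<close> suffices. The
  values 0 and 1 are separate because \<open>k - 1\<close> is not positive there.\<close>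

lemma symmetrized_gain_density_1:
  assumes "k \<ge> 0"
  shows "gain_density 1 k + gain_density 1 (- k) - 1 = half_chain 1 (k + 1) - half_chain 1 (k - 1)"
proof -
  consider "k = 0" | "k = 1" | n where "k = int n + 2"
  proof -
    have "k = int (nat (k - 2)) + 2" if "k \<noteq> 0" "k \<noteq> 1" using assms that by simp
    then show thesis using that by blast
  qed
  then show ?thesis
  proof cases
    case 3
    then have nat: "nat (2 - k) = 0" "nat (2 - - k) = n + 4" "nat \<bar>k - 1\<bar> = n + 1"
      "nat \<bar>k + 1\<bar> = n + 3" and sgn: "sgn (k - 1) = 1" "sgn (k + 1) = 1" by simp_all
    have "half_chain 1 (k - 1) = (if even k then 1/6 else 1/3) + (1/2) ^ n / 12"
      unfolding half_chain_def One_nat_def chain.simps nat sgn by (simp add: power_add power_divide)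
    moreover have "half_chain 1 (k + 1) = (if even k then 1/6 else 1/3) + (1/2) ^ n / 48"
      unfolding half_chain_def One_nat_def chain.simps nat sgn by (simp add: power_add power_divide)
    moreover have "gain_density 1 k = 0" "gain_density 1 (- k) = 1 - (1/2) ^ n / 16"
      unfolding gain_density_def One_nat_def chain.simps nat by (simp_all add: power_add power_divide)
    ultimately show ?thesis by simp
  next
    case 1
    have "nat (2::int) = Suc (Suc 0)" by simp
    with 1 show ?thesis by (simp add: gain_density_def half_chain_def power_divide)
  next
    case 2
    have "nat (3::int) = Suc (Suc (Suc 0))" "nat (2::int) = Suc (Suc 0)" by simp_all
    with 2 show ?thesis by (simp add: gain_density_def half_chain_def power_divide)
  qed
qed

text \<open>The coefficients of the recursion sum to 1, so it preserves constants, and subtracting 1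
  is compatible with it. Only the two initial levels need computation.\<close>

lemma symmetrized_gain_density:
  "gain_density j k + gain_density j (- k) - 1 = half_chain j (k + 1) - half_chain j (k - 1)"
proof (induction j arbitrary: k rule: induct_nat_012)
  case 0
  show ?case
  proof (cases "\<bar>k\<bar> \<le> 1")
    case True
    then have "k = -1 \<or> k = 0 \<or> k = 1" by linarith
    then show ?thesis by (auto simp: gain_density_def half_chain_def)
  next
    case False
    then show ?thesis by (auto simp: gain_density_def half_chain_def sgn_if)
  qed
next
  case 1
  show ?case
  proof (cases "k \<ge> 0")
    case True
    then show ?thesis using symmetrized_gain_density_1 by simp
  next
    case False
    then show ?thesis
      using symmetrized_gain_density_1[of "- k"] half_chain_minus[of 1 "k + 1"]
        half_chain_minus[of 1 "k - 1"] by simp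
  qed
next
  case (ge2 j)
  have shift: "- (k + 1) = - k - 1" "- (k - 1) = - k + 1" "k + 1 + 1 = k + 2" "k + 1 - 1 = k"
    "k - 1 + 1 = k" "k - 1 - 1 = k - 2" by simp_all
  show ?case
    unfolding gain_density_rec half_chain_rec shift add_divide_distrib diff_divide_distrib
    using ge2(1)[of k] ge2(2)[of k] ge2(2)[of "k + 1", unfolded shift]
      ge2(2)[of "k - 1", unfolded shift]
    by linarith
qed

(* The recursion splits into two steps with nonnegative coefficients, and its restriction to
   positive indices is closed because odd functions vanish at 0. *)
lemma half_chain_pos:
  "i \<ge> 1 \<Longrightarrow> half_chain j i > 0 \<or> (j = 0 \<and> half_chain j i \<ge> 0)"
  "i \<ge> 1 \<Longrightarrow> half_chain (Suc j) i - half_chain j (i - 1) / 2 > 0"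
proof (induction j arbitrary: i)
  case 0
  case 1
  then show ?case by (auto simp: half_chain_def)
  case 2
  show ?case
  proof (cases "i = 1")
    case False
    then have "i > 1" using 2 by simp
    define e where "e = (1/2::real) ^ nat i"
    \<comment> \<open>For even \<open>i\<close> the odd predecessor costs 1/4, leaving 1/3 - 1/4 =
      1/12; for odd \<open>i\<close> it costs nothing.\<close>
    have "half_chain (Suc 0) i - half_chain 0 (i - 1) / 2 = (if odd i then 1/6 else 1/12) + e / 6"
      using \<open>i > 1\<close> by (auto simp: half_chain_def e_def)
    moreover have "e > 0" by (simp add: e_def)
    ultimately show ?thesis by (simp split: if_splits)
  qed (simp add: half_chain_def)
next
  case (Suc j)
  \<comment> \<open>At \<open>i = 1\<close> the predecessor index 0 lies outside the induction
    hypothesis.\<close>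
  have zero: "half_chain j 0 = 0" for j using half_chain_minus[of j 0] by simp
  have nonneg: "half_chain j i \<ge> 0" if "i \<ge> 0" for i
    using Suc.IH(1)[of i] zero[of j] that by (cases "i = 0") auto
  {
    case 1
    then show ?case using Suc.IH(2)[of i] nonneg[of "i - 1"] by simp
  next
    case 2
    have "half_chain (Suc j) i > 0"
      using 2 Suc.IH(2)[of i] nonneg[of "i - 1"] by simp
    \<comment> \<open>The subtracted quarter of \<open>half_chain j i\<close> is absorbed into the
      auxiliary difference at \<open>i + 1\<close>, so only nonnegative coefficients remain.\<close>
    moreover have "half_chain (Suc (Suc j)) i - half_chain (Suc j) (i - 1) / 2 =
      (half_chain (Suc j) (i + 1) - half_chain j i / 2) / 2 + half_chain (Suc j) i / 4"
      by (simp add: half_chain_rec field_simps)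
    ultimately show ?case using 2 Suc.IH(2)[of "i + 1"]
      by (simp add: diff_divide_distrib)
  }
qed

lemma cdens_tj_gt_half:
  assumes "j \<ge> 1"
  shows "cdens (tj j) > 1/2"
  using symmetrized_gain_density[of j 0] half_chain_minus[of j 1] half_chain_pos(1)[of 1 j] assms
  by (simp add: cdens_tj)

section \<open>Fourier representation\<close>

lemma has_integral_cos_multiple:
  "((\<lambda>t. cos (of_int k * t)) has_integral (if k = 0 then pi else 0)) {0..pi}"
proof (cases "k = 0")
  case True
  then show ?thesis using has_integral_const_real[of "1::real" 0 pi] by simp
next
  case False
  have "((\<lambda>t. cos (of_int k * t)) has_integral
      (sin (of_int k * pi) / of_int k - sin (of_int k * 0) / of_int k)) {0..pi}"
    using False by (intro fundamental_theorem_of_calculus)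
      (auto intro!: derivative_eq_intros simp flip: has_real_derivative_iff_has_vector_derivative)
  moreover have "sin (of_int k * pi) = 0"
    by (auto simp: sin_zero_iff_int2)
  ultimately show ?thesis using False by simp
qed

lemma cos_mult_cos_multiple:
  "cos t * cos (of_int k * t) = (cos (of_int (k + 1) * t) + cos (of_int (k - 1) * t)) / (2::real)"
  using cos_times_cos[of "of_int k * t" t] by (simp add: algebra_simps)

text \<open>The Poisson kernel of radius 1/2 is 3 / (5 - 4 cos t). Its coefficients 2^(-|k|) are
  needed for the geometric tail of \<open>gain_density 1\<close>.\<close>

definition poisson :: "int \<Rightarrow> real" where
  "poisson k = integral {0..pi} (\<lambda>t. cos (of_int k * t) / (5 - 4 * cos t))"

lemma five_minus_four_cos_pos: "5 - 4 * cos (t::real) > 0"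
  using cos_le_one[of t] by linarith

lemma poisson_has_integral:
  "((\<lambda>t. cos (of_int k * t) / (5 - 4 * cos t)) has_integral poisson k) {0..pi}"
  unfolding poisson_def using five_minus_four_cos_pos
  by (intro integrable_integral integrable_continuous_real continuous_intros) (simp add: less_le)

text \<open>Multiplying the kernel by its own denominator leaves cos (k t), and multiplication by
  cos t averages the two neighbouring coefficients.\<close>

lemma poisson_rec: "5 * poisson k - 2 * poisson (k + 1) - 2 * poisson (k - 1) = (if k = 0 then pi else 0)"
proof -
  have "((\<lambda>t. 5 * (cos (of_int k * t) / (5 - 4 * cos t))
        - 2 * (cos (of_int (k + 1) * t) / (5 - 4 * cos t))
        - 2 * (cos (of_int (k - 1) * t) / (5 - 4 * cos t))) has_integral
      (5 * poisson k - 2 * poisson (k + 1) - 2 * poisson (k - 1))) {0..pi}"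
    by (intro has_integral_diff has_integral_mult_right poisson_has_integral)
  moreover have "(\<lambda>t::real. 5 * (cos (of_int k * t) / (5 - 4 * cos t))
        - 2 * (cos (of_int (k + 1) * t) / (5 - 4 * cos t))
        - 2 * (cos (of_int (k - 1) * t) / (5 - 4 * cos t))) = (\<lambda>t. cos (of_int k * t))"
  proof (rule ext)
    fix t :: real
    have "5 * cos (of_int k * t) - 2 * cos (of_int (k + 1) * t) - 2 * cos (of_int (k - 1) * t)
        = cos (of_int k * t) * (5 - 4 * cos t)"
      using cos_mult_cos_multiple[of t k] by (simp add: algebra_simps)
    then show "5 * (cos (of_int k * t) / (5 - 4 * cos t))
        - 2 * (cos (of_int (k + 1) * t) / (5 - 4 * cos t))
        - 2 * (cos (of_int (k - 1) * t) / (5 - 4 * cos t)) = cos (of_int k * t)"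
      by (simp only: times_divide_eq_right diff_divide_distrib[symmetric]
          nonzero_mult_div_cancel_right[OF less_imp_neq[OF five_minus_four_cos_pos[of t], symmetric]])
  qed
  ultimately show ?thesis
    by (simp only: has_integral_unique[OF _ has_integral_cos_multiple[of k]])
qed

lemma poisson_bound: "\<bar>poisson k\<bar> \<le> pi"
proof -
  have "norm (poisson k) \<le> 1 * (pi - 0)"
    unfolding content_real[OF pi_ge_zero, symmetric]
  proof (rule has_integral_bound_real[OF _ _ poisson_has_integral])
    fix t :: real
    have "\<bar>cos (of_int k * t)\<bar> \<le> 5 - 4 * cos t"
      using abs_cos_le_one[of "of_int k * t"] cos_le_one[of t] by linarith
    then show "norm (cos (of_int k * t) / (5 - 4 * cos t)) \<le> 1"
      using five_minus_four_cos_pos[of t] by simp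
  qed auto
  then show ?thesis by simp
qed

(* The recursion has the solutions 2^k and 2^(-k); boundedness excludes the first. *)
lemma poisson_eq: "poisson k = pi / 3 * (1/2) ^ nat \<bar>k\<bar>"
proof -
  have sym: "poisson (- k) = poisson k" for k by (simp add: poisson_def)
  define e where "e = poisson 1 - poisson 0 / 2"
  \<comment> \<open>Subtracting half the preceding value removes the decaying solution; what is left
    doubles at every step.\<close>
  have growth: "poisson (int n + 1) - poisson (int n) / 2 = 2 ^ n * e" for n
  proof (induction n)
    case (Suc n)
    have shift: "int (Suc n) = int n + 1" "int n + 1 + 1 = int n + 2" "int n + 1 - 1 = int n"
      "(int n + 1 = 0) = False" by simp_all
    show ?case
      using Suc.IH poisson_rec[of "int n + 1"]
      unfolding shift power_Suc if_False by linarith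
  qed (simp add: e_def)
  have bound: "2 ^ n * \<bar>e\<bar> \<le> 2 * pi" for n
  proof -
    have "\<bar>2 ^ n * e\<bar> \<le> 2 * pi"
      using growth[of n] poisson_bound[of "int n + 1"] poisson_bound[of "int n"] by linarith
    then show ?thesis by (simp add: abs_mult)
  qed
  have "e = 0"
  proof (rule ccontr)
    assume "e \<noteq> 0"
    obtain n where "2 * pi / \<bar>e\<bar> < 2 ^ n" using real_arch_pow[of 2] by auto
    then show False using bound[of n] \<open>e \<noteq> 0\<close> by (simp add: field_simps)
  qed
  then have half: "poisson (int n + 1) = poisson (int n) / 2" for n using growth[of n] by simp
  have "poisson 0 = pi / 3" using poisson_rec[of 0] half[of 0] sym[of 1] by simp
  then have "poisson (int n) = pi / 3 * (1/2) ^ n" for n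
  proof (induction n)
    case (Suc n)
    then show ?case using half[of n] by (simp add: add.commute)
  qed simp
  then have "poisson \<bar>k\<bar> = pi / 3 * (1/2) ^ nat \<bar>k\<bar>" by (metis abs_ge_zero int_nat_eq)
  moreover have "poisson \<bar>k\<bar> = poisson k" using sym[of k] by (simp add: abs_if)
  ultimately show ?thesis by simp
qed

text \<open>The Fourier series of f(j,k) in k, written in x = cos t. Averaging over neighbours
  becomes multiplication by x. At level 1, f(1,k) is 3/4 at 0 plus 1/2 at each of 1 and -1, minus
  2^(-|k|)/4 everywhere; these give the three terms in turn.\<close>

fun fourier_symbol :: "nat \<Rightarrow> real \<Rightarrow> real" where
  "fourier_symbol 0 x = 1"
| "fourier_symbol (Suc 0) x = 3/4 + x - 3/4 * (1 / (5 - 4 * x))"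
| "fourier_symbol (Suc (Suc j)) x = (x + 1/4) * fourier_symbol (Suc j) x - fourier_symbol j x / 4"

text \<open>The symmetrized density is even in \<open>k\<close>, so its series is a cosine series,
  and half a period recovers each coefficient up to the factor pi.\<close>

lemma gain_density_fourier:
  "((\<lambda>t. fourier_symbol j (cos t) * cos (of_int k * t)) has_integral
     (pi * (gain_density j k + gain_density j (- k) - 1))) {0..pi}"
proof (induction j arbitrary: k rule: induct_nat_012)
  case 0
  show ?case using has_integral_cos_multiple[of k] by (auto simp: gain_density_def)
next
  case 1
  let ?c = "\<lambda>i. if i = 0 then pi else 0"
  have "((\<lambda>t. 3/4 * cos (of_int k * t)
       + 1/2 * cos (of_int (k + 1) * t) + 1/2 * cos (of_int (k - 1) * t)
       - 3/4 * (cos (of_int k * t) / (5 - 4 * cos t))) has_integral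
       (3/4 * ?c k + 1/2 * ?c (k + 1) + 1/2 * ?c (k - 1) - 3/4 * poisson k)) {0..pi}"
    by (intro has_integral_diff has_integral_add has_integral_mult_right poisson_has_integral
        has_integral_cos_multiple)
  moreover have "3/4 * cos (of_int k * t)
       + 1/2 * cos (of_int (k + 1) * t) + 1/2 * cos (of_int (k - 1) * t)
       - 3/4 * (cos (of_int k * t) / (5 - 4 * cos t)) = fourier_symbol 1 (cos t) * cos (of_int k * t)" for t
    using cos_mult_cos_multiple[of t k] by (simp add: algebra_simps)
  moreover have "3/4 * ?c k + 1/2 * ?c (k + 1) + 1/2 * ?c (k - 1) - 3/4 * poisson k
      = pi * (gain_density 1 k + gain_density 1 (- k) - 1)"
  proof -
    consider "k = 0" | "k = 1" | "k = -1" | n where "k = int n + 2" | n where "k = - int n - 2"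
    proof -
      have "k = int (nat (k - 2)) + 2 \<or> k = - int (nat (- k - 2)) - 2"
        if "k \<noteq> 0" "k \<noteq> 1" "k \<noteq> -1" using that by linarith
      then show thesis using that by blast
    qed
    then show ?thesis
    proof cases
      case 4
      then have "nat (2 + k) = n + 4" "nat \<bar>k\<bar> = n + 2" by simp_all
      with 4 show ?thesis by (simp add: poisson_eq gain_density_def power_add power_divide algebra_simps)
    next
      case 5
      then have "nat (2 - k) = n + 4" "nat \<bar>k\<bar> = n + 2" by simp_all
      with 5 show ?thesis by (simp add: poisson_eq gain_density_def power_add power_divide algebra_simps)
    qed (simp_all add: poisson_eq gain_density_def numeral_eq_Suc)
  qed
  ultimately show ?case by simp
next
  case (ge2 j)
  have shift: "- (k + 1) = - k - 1" "- (k - 1) = - k + 1" by simp_all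
  have "((\<lambda>t. 1/2 * (fourier_symbol (Suc j) (cos t) * cos (of_int (k + 1) * t))
       + 1/2 * (fourier_symbol (Suc j) (cos t) * cos (of_int (k - 1) * t))
       + 1/4 * (fourier_symbol (Suc j) (cos t) * cos (of_int k * t))
       - 1/4 * (fourier_symbol j (cos t) * cos (of_int k * t))) has_integral
       (1/2 * (pi * (gain_density (Suc j) (k + 1) + gain_density (Suc j) (- (k + 1)) - 1))
       + 1/2 * (pi * (gain_density (Suc j) (k - 1) + gain_density (Suc j) (- (k - 1)) - 1))
       + 1/4 * (pi * (gain_density (Suc j) k + gain_density (Suc j) (- k) - 1))
       - 1/4 * (pi * (gain_density j k + gain_density j (- k) - 1)))) {0..pi}"
    by (intro has_integral_diff has_integral_add has_integral_mult_right ge2.IH)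
  moreover have "1/2 * (fourier_symbol (Suc j) (cos t) * cos (of_int (k + 1) * t))
       + 1/2 * (fourier_symbol (Suc j) (cos t) * cos (of_int (k - 1) * t))
       + 1/4 * (fourier_symbol (Suc j) (cos t) * cos (of_int k * t))
       - 1/4 * (fourier_symbol j (cos t) * cos (of_int k * t))
       = fourier_symbol (Suc (Suc j)) (cos t) * cos (of_int k * t)" for t
  proof -
    have "fourier_symbol (Suc (Suc j)) (cos t) * cos (of_int k * t) =
      fourier_symbol (Suc j) (cos t) * (cos t * cos (of_int k * t))
       + 1/4 * (fourier_symbol (Suc j) (cos t) * cos (of_int k * t))
       - 1/4 * (fourier_symbol j (cos t) * cos (of_int k * t))"
      by (simp add: algebra_simps)
    then show ?thesis unfolding cos_mult_cos_multiple by (simp add: algebra_simps add_divide_distrib)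
  qed
  moreover have "1/2 * (pi * (gain_density (Suc j) (k + 1) + gain_density (Suc j) (- (k + 1)) - 1))
       + 1/2 * (pi * (gain_density (Suc j) (k - 1) + gain_density (Suc j) (- (k - 1)) - 1))
       + 1/4 * (pi * (gain_density (Suc j) k + gain_density (Suc j) (- k) - 1))
       - 1/4 * (pi * (gain_density j k + gain_density j (- k) - 1))
       = pi * (gain_density (Suc (Suc j)) k + gain_density (Suc (Suc j)) (- k) - 1)"
    unfolding gain_density_rec shift add_divide_distrib diff_divide_distrib
    by (simp add: algebra_simps)
  ultimately show ?case by simp
qed

lemma cdens_tj_integral:
  "((\<lambda>t. fourier_symbol j (cos t)) has_integral (2 * pi * (cdens (tj j) - 1/2))) {0..pi}"
  using gain_density_fourier[of j 0] by (simp add: cdens_tj algebra_simps)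

text \<open>The only pole, x = 5/4, lies to the right of all values of the cosine.\<close>

lemma fourier_symbol_continuous: "continuous_on {..1} (fourier_symbol j)"
proof (induction j rule: induct_nat_012)
  case (ge2 j)
  then show ?case by (auto intro!: continuous_intros)
qed (auto intro!: continuous_intros)

(* With v j = 2^j * fourier_symbol j x and T = x + 1/4, the quantity
   (v (j+1))^2 - 2 T (v j) (v (j+1)) + (v j)^2 does not depend on j. *)
lemma fourier_symbol_tail_bound:
  assumes "x \<ge> -1" and "x \<le> 3/4"
  shows "\<bar>fourier_symbol j x\<bar> \<le> (5 * real j + 1) / 2 ^ j"
proof -
  define v where "v j = 2 ^ j * fourier_symbol j x" for j
  define T where "T = x + 1/4"
  have T: "\<bar>T\<bar> \<le> 1" using assms by (simp add: T_def abs_le_iff)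
  have rec: "v (Suc (Suc j)) = 2 * T * v (Suc j) - v j" for j
    by (simp add: v_def T_def algebra_simps)
  have v0: "v 0 = 1" by (simp add: v_def)
  have "1 / (5 - 4 * x) \<le> 1" "1 / (5 - 4 * x) \<ge> 0" using assms by (simp_all add: field_simps)
  then have "\<bar>fourier_symbol 1 x\<bar> \<le> 2" using assms unfolding One_nat_def fourier_symbol.simps by linarith
  then have v1: "\<bar>v 1\<bar> \<le> 4" by (simp add: v_def)
  have inv: "(v (Suc j))\<^sup>2 - 2 * T * v j * v (Suc j) + (v j)\<^sup>2 = (v 1)\<^sup>2 - 2 * T * v 0 * v 1 + (v 0)\<^sup>2" for j
  proof (induction j)
    case (Suc j)
    then show ?case unfolding rec by (simp add: power2_eq_square algebra_simps)
  qed simp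
  \<comment> \<open>25 = 16 + 8 + 1, from \<open>\<bar>v 1\<bar> \<le> 4\<close>,
    \<open>\<bar>T\<bar> \<le> 1\<close> and \<open>v 0 = 1\<close>.\<close>
  have "(v 1)\<^sup>2 - 2 * T * v 0 * v 1 + (v 0)\<^sup>2 \<le> 5\<^sup>2"
  proof -
    have "(v 1)\<^sup>2 \<le> 4\<^sup>2" using v1 abs_le_square_iff[of "v 1" 4] by simp
    moreover have "\<bar>T * v 1\<bar> \<le> 1 * 4" unfolding abs_mult using T v1 by (intro mult_mono) auto
    ultimately show ?thesis using v0 by (simp add: abs_le_iff)
  qed
  then have energy: "(v (Suc j) - T * v j)\<^sup>2 + (1 - T\<^sup>2) * (v j)\<^sup>2 \<le> 5\<^sup>2" for j
    using inv[of j] by (simp add: power2_eq_square algebra_simps)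
  \<comment> \<open>With the square completed, \<open>\<bar>T\<bar> \<le> 1\<close> lets the second
    term be dropped. This costs linear growth but stays uniform up to the double root at
    \<open>T = 1\<close>.\<close>
  have step: "\<bar>v (Suc j)\<bar> \<le> \<bar>v j\<bar> + 5" for j
  proof -
    have "T\<^sup>2 \<le> 1" using T by (simp add: abs_square_le_1)
    then have "(1 - T\<^sup>2) * (v j)\<^sup>2 \<ge> 0" by simp
    then have "(v (Suc j) - T * v j)\<^sup>2 \<le> 5\<^sup>2" using energy[of j] by linarith
    then have "\<bar>v (Suc j) - T * v j\<bar> \<le> 5" 
      using abs_le_square_iff[of "v (Suc j) - T * v j" 5] by simp
    moreover have "\<bar>T * v j\<bar> \<le> 1 * \<bar>v j\<bar>" unfolding abs_mult using T by (intro mult_right_mono) auto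
    ultimately show ?thesis by linarith
  qed
  have "\<bar>v j\<bar> \<le> 5 * real j + 1"
  proof (induction j)
    case (Suc j)
    then show ?case using step[of j] by simp
  qed (simp add: v0)
  then show ?thesis by (simp add: v_def abs_mult field_simps)
qed

section \<open>Wallis integrals\<close>

definition wallis_integral :: "nat \<Rightarrow> real" where
  "wallis_integral n = integral {0..pi/2} (\<lambda>t. cos t ^ n)"

lemma wallis_has_integral: "((\<lambda>t. cos t ^ n) has_integral wallis_integral n) {0..pi/2}"
  unfolding wallis_integral_def
  by (intro integrable_integral integrable_continuous_real continuous_intros)

text \<open>The integrand combination is the derivative of sin t cos^(n+1) t, which vanishes at both
  endpoints.\<close>

lemma wallis_integral_rec: "(real n + 2) * wallis_integral (n + 2) = (real n + 1) * wallis_integral n"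
proof -
  have "((\<lambda>t. (real n + 2) * cos t ^ (n + 2) - (real n + 1) * cos t ^ n) has_integral
      (sin (pi/2) * cos (pi/2) ^ (n + 1) - sin 0 * cos 0 ^ (n + 1))) {0..pi/2}"
  proof (rule fundamental_theorem_of_calculus)
    fix t :: real
    have "((\<lambda>t. sin t * cos t ^ Suc n) has_real_derivative
        cos t * cos t ^ Suc n + (1 + real n) * (- sin t * cos t ^ n) * sin t) (at t within {0..pi/2})"
      by (rule has_field_derivative_at_within)
        (rule DERIV_mult[OF DERIV_sin DERIV_power_Suc[OF DERIV_cos]])
    also have "cos t * cos t ^ Suc n + (1 + real n) * (- sin t * cos t ^ n) * sin t =
        (real n + 2) * cos t ^ (n + 2) - (real n + 1) * cos t ^ n"
    proof -
      have "cos t * cos t ^ Suc n + (1 + real n) * (- sin t * cos t ^ n) * sin t =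
          cos t ^ (n + 2) - (real n + 1) * cos t ^ n * (sin t)\<^sup>2"
        by (simp add: power2_eq_square)
      also have "\<dots> = cos t ^ (n + 2) - (real n + 1) * cos t ^ n * (1 - cos t ^ 2)"
        by (simp only: sin_squared_eq)
      also have "\<dots> = (real n + 2) * cos t ^ (n + 2) - (real n + 1) * cos t ^ n"
        unfolding power_add by algebra
      finally show ?thesis .
    qed
    finally show "((\<lambda>t. sin t * cos t ^ (n + 1)) has_vector_derivative
        (real n + 2) * cos t ^ (n + 2) - (real n + 1) * cos t ^ n) (at t within {0..pi/2})"
      by (simp add: has_real_derivative_iff_has_vector_derivative)
  qed simp
  moreover have "((\<lambda>t. (real n + 2) * cos t ^ (n + 2) - (real n + 1) * cos t ^ n) has_integral
      ((real n + 2) * wallis_integral (n + 2) - (real n + 1) * wallis_integral n)) {0..pi/2}"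
    by (intro has_integral_diff has_integral_mult_right wallis_has_integral)
  ultimately have "(real n + 2) * wallis_integral (n + 2) - (real n + 1) * wallis_integral n = 
     sin (pi/2) * cos (pi/2) ^ (n + 1) - sin 0 * cos 0 ^ (n + 1)"
    using has_integral_unique by blast
  then show ?thesis by simp
qed

lemma cos_nonneg_quadrant: "0 \<le> t \<Longrightarrow> t \<le> pi / 2 \<Longrightarrow> 0 \<le> cos t"
  using cos_ge_zero[of t] pi_ge_zero by linarith

lemma wallis_integral_nonneg: "wallis_integral n \<ge> 0"
  using wallis_has_integral by (rule has_integral_nonneg) (simp add: cos_nonneg_quadrant)

lemma wallis_integral_Suc_le: "wallis_integral (Suc n) \<le> wallis_integral n"
  using wallis_has_integral[of "Suc n"] wallis_has_integral[of n]
  by (rule has_integral_le) (simp add: cos_nonneg_quadrant mult_left_le_one_le)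

text \<open>By the two-step recursion, (n + 1) times the product of consecutive integrals is
  constant, equal to pi/2. Monotonicity then traps each square between two such products.\<close>

lemma wallis_integral_product: "wallis_integral (Suc n) * wallis_integral n = pi / (2 * (real n + 1))"
proof (induction n)
  case 0
  have "wallis_integral 0 = pi / 2" by (simp add: wallis_integral_def)
  moreover have "((\<lambda>t. cos t) has_integral (sin (pi/2) - sin 0)) {0..pi/2}"
    by (intro fundamental_theorem_of_calculus)
      (auto intro!: derivative_eq_intros simp flip: has_real_derivative_iff_has_vector_derivative)
  then have "wallis_integral 1 = 1"
    unfolding wallis_integral_def by (simp add: integral_unique)
  ultimately show ?case by simp
next
  case (Suc n)
  have "wallis_integral (Suc (Suc n)) = (real n + 1) / (real n + 2) * wallis_integral n"
    using wallis_integral_rec[of n] by (simp add: field_simps)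
  then have "wallis_integral (Suc (Suc n)) * wallis_integral (Suc n) =
      (real n + 1) / (real n + 2) * (wallis_integral (Suc n) * wallis_integral n)" by simp
  also have "\<dots> = pi / (2 * (real n + 2))"
    unfolding Suc.IH using add_pos_nonneg[of 1 "real n"] by (simp add: divide_simps) (simp add: algebra_simps)
  finally show ?case by (simp add: algebra_simps)
qed

lemma wallis_integral_square_le: "(wallis_integral (Suc n))\<^sup>2 \<le> pi / (2 * real (Suc n))"
proof -
  have "(wallis_integral (Suc n))\<^sup>2 \<le> wallis_integral (Suc n) * wallis_integral n"
    unfolding power2_eq_square
    by (intro mult_left_mono wallis_integral_Suc_le wallis_integral_nonneg)
  then show ?thesis by (simp add: wallis_integral_product add.commute)
qed

lemma wallis_integral_square_ge: "(wallis_integral n)\<^sup>2 \<ge> pi / (2 * (real n + 1))"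
proof -
  have "wallis_integral (Suc n) * wallis_integral n \<le> (wallis_integral n)\<^sup>2"
    unfolding power2_eq_square
    by (intro mult_right_mono wallis_integral_Suc_le wallis_integral_nonneg)
  then show ?thesis by (simp add: wallis_integral_product)
qed

section \<open>Asymptotics\<close>

(* x = l + 1/(4 l) - 1/4 makes l and 1/(4 l) the characteristic roots of the recursion for
   fourier_symbol. *)
definition root_param :: "real \<Rightarrow> real" where
  "root_param l = l + 1 / (4 * l) - 1/4"

text \<open>With x = \<open>root_param l\<close> and l = cos^2 p, sqrt (1 - x^2) = sin p *
  \<open>root_weight l\<close>; this is the part of the Jacobian left once sin p cancels.\<close>

definition root_weight :: "real \<Rightarrow> real" where
  "root_weight l = sqrt ((1 - 1 / (4 * l)) * (1 + root_param l))"

text \<open>A Binet formula. It is kept multiplied by \<open>l - m\<close> so that it also makes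
  sense at the double root; the Jacobian of the later substitution supplies this factor.\<close>

lemma fourier_symbol_closed_form:
  fixes l m :: real
  assumes "l * m = 1/4"
  shows "(l - m) * fourier_symbol (Suc j) (l + m - 1/4) =
     l ^ Suc j * (fourier_symbol 1 (l + m - 1/4) - m) - m ^ Suc j * (fourier_symbol 1 (l + m - 1/4) - l)"
proof (induction j rule: induct_nat_012)
  case 0
  show ?case by (simp add: algebra_simps del: fourier_symbol.simps)
next
  case 1
  define P where "P = fourier_symbol (Suc 0) (l + m - 1/4)"
  have rec: "fourier_symbol (Suc (Suc 0)) (l + m - 1/4) = (l + m) * P - l * m"
    using assms by (simp add: P_def)
  show ?case unfolding rec One_nat_def P_def[symmetric] power_Suc power_0 by algebra
next
  case (ge2 j)
  define P where "P = fourier_symbol 1 (l + m - 1/4)"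
  define Q where "Q i = fourier_symbol i (l + m - 1/4)" for i
  have rec: "Q (Suc (Suc (Suc j))) = (l + m) * Q (Suc (Suc j)) - (l * m) * Q (Suc j)"
    using assms by (simp add: Q_def)
  have "(l - m) * Q (Suc (Suc (Suc j))) = (l + m) * ((l - m) * Q (Suc (Suc j))) - (l * m) * ((l - m) * Q (Suc j))"
    unfolding rec by algebra
  also have "\<dots> = (l + m) * (l ^ Suc (Suc j) * (P - m) - m ^ Suc (Suc j) * (P - l))
     - (l * m) * (l ^ Suc j * (P - m) - m ^ Suc j * (P - l))"
    using ge2 unfolding P_def Q_def by simp
  also have "\<dots> = l ^ Suc (Suc (Suc j)) * (P - m) - m ^ Suc (Suc (Suc j)) * (P - l)"
    unfolding power_Suc by algebra
  finally show ?case unfolding P_def Q_def .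
qed

lemma one_minus_root_param:
  assumes "l > 0"
  shows "1 - root_param l = (1 - l) * (1 - 1 / (4 * l))"
  using assms by (simp add: root_param_def field_simps)

section \<open>Estimates for the larger root, 1/2 \<le> l \<le> 1\<close>

context
  fixes l :: real
  assumes l: "1/2 \<le> l" "l \<le> 1"
begin

lemma inverse_root_bounds: "1/4 \<le> 1 / (4 * l)" "1 / (4 * l) \<le> 1/2" "1 / (4 * l) - 1/4 \<le> (1 - l) / 2"
proof -
  show "1/4 \<le> 1 / (4 * l)" "1 / (4 * l) \<le> 1/2" using l by (simp_all add: field_simps)
  have "1 / (4 * l) - 1/4 = (1 - l) * (1 / (4 * l))" using l by (simp add: field_simps)
  also have "\<dots> \<le> (1 - l) * (1/2)" using l by (intro mult_left_mono) (simp_all add: field_simps)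
  finally show "1 / (4 * l) - 1/4 \<le> (1 - l) / 2" by simp
qed

lemma root_param_bounds: "3/4 \<le> root_param l" "root_param l \<le> 1" "1 - root_param l \<le> 1 - l"
proof -
  have eq: "1 - root_param l = (1 - l) * (1 - 1 / (4 * l))"
    using one_minus_root_param l by simp
  have "0 \<le> (1 - l) * (1 - 1 / (4 * l))"
    using l inverse_root_bounds by (intro mult_nonneg_nonneg) simp_all
  then show "root_param l \<le> 1" using eq by linarith
  show "1 - root_param l \<le> 1 - l"
    unfolding eq using l inverse_root_bounds by (intro mult_left_le) simp_all
  have "root_param l - 3/4 = (l - 1/2)\<^sup>2 / l"
    using l by (simp add: root_param_def field_simps power2_eq_square)
  also have "\<dots> \<ge> 0" using l by simp
  finally show "3/4 \<le> root_param l" by simp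
qed

text \<open>This keeps the denominators away from 0, including at the double root l = 1/2.\<close>

lemma root_weight_ge: "root_weight l \<ge> 1/2"
proof -
  have "1/2 * (7/4) \<le> (1 - 1 / (4 * l)) * (1 + root_param l)"
    using inverse_root_bounds root_param_bounds by (intro mult_mono) auto
  then show ?thesis unfolding root_weight_def by (intro real_le_rsqrt) (simp add: power2_eq_square)
qed

lemma fourier_symbol_1_root_param: "\<bar>fourier_symbol 1 (root_param l) - 1\<bar> \<le> 2 * (1 - l)"
proof -
  let ?x = "root_param l"
  have "fourier_symbol 1 ?x - 1 = (1 - ?x) * (3 / (5 - 4 * ?x) - 1)"
    using root_param_bounds by (simp add: field_simps)
  then have "\<bar>fourier_symbol 1 ?x - 1\<bar> = \<bar>1 - ?x\<bar> * \<bar>3 / (5 - 4 * ?x) - 1\<bar>"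
    by (simp only: abs_mult)
  also have "\<dots> \<le> (1 - l) * 2"
    using root_param_bounds l by (intro mult_mono) (simp_all add: abs_le_iff field_simps)
  finally show ?thesis by (simp only: mult.commute)
qed

text \<open>At l = 1 the numerator is 2 (1 - 1/4) = 3/2 and the squared weight is 3/4 * 2 = 3/2, so
  the quotient is sqrt (3/2). Lipschitz bounds 5 (numerator) and 2 * 2 (weight, times
  \<open>s \<le> 2\<close>), divided by 1/2, give 18.\<close>

lemma main_factor_estimate:
  "\<bar>2 * (fourier_symbol 1 (root_param l) - 1 / (4 * l)) / root_weight l - sqrt (3/2)\<bar> \<le> 18 * (1 - l)"
proof -
  define s where "s = sqrt (3/2)"
  define R where "R = root_weight l"
  define P where "P = fourier_symbol 1 (root_param l)"
  define m where "m = 1 / (4 * l)"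
  define N where "N = 2 * (P - m)"
  have P: "\<bar>P - 1\<bar> \<le> 2 * (1 - l)" unfolding P_def by (rule fourier_symbol_1_root_param)
  note m = inverse_root_bounds[folded m_def]
  have s: "1 \<le> s" "s \<le> 2" "s * s = 3/2" by (auto simp: s_def intro!: real_le_lsqrt)
  have R: "R \<ge> 1/2" using root_weight_ge by (simp add: R_def)
  have N: "\<bar>N - 3/2\<bar> \<le> 5 * (1 - l)"
    using P m unfolding N_def right_diff_distrib diff_divide_distrib by linarith
  have RR: "R * R = (1 - m) * (1 + root_param l)"
    using m root_param_bounds by (simp add: R_def root_weight_def m_def)
  define X where "X = (m - 1/4) * (1 + root_param l)"
  have sq: "s * s - R * R = X + 3/4 * (1 - root_param l)"
    unfolding s(3) RR X_def by (simp add: algebra_simps add_divide_distrib diff_divide_distrib)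
  have "X \<le> ((1 - l) / 2) * 2"
    unfolding X_def using m root_param_bounds l by (intro mult_mono) auto
  then have "X \<le> 1 - l" by simp
  moreover have "0 \<le> X"
    unfolding X_def using m root_param_bounds by (intro mult_nonneg_nonneg) auto
  ultimately have sq_bound: "\<bar>s * s - R * R\<bar> \<le> 2 * (1 - l)"
    unfolding sq right_diff_distrib diff_divide_distrib using root_param_bounds by linarith
  \<comment> \<open>Since \<open>s + R \<ge> 1\<close>, a bound on the difference of squares bounds
    the difference.\<close>
  have "\<bar>s - R\<bar> \<le> \<bar>s - R\<bar> * (s + R)" using s R by (simp add: mult_le_cancel_left1)
  also have "\<dots> = \<bar>(s - R) * (s + R)\<bar>" unfolding abs_mult using s R by simp
  also have "(s - R) * (s + R) = s * s - R * R" by algebra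
  finally have diff: "\<bar>s - R\<bar> \<le> 2 * (1 - l)" using sq_bound by linarith
  have "N / R - s = ((N - 3/2) + s * (s - R)) / R"
    using R s by (simp add: field_simps)
  also have "\<bar>\<dots>\<bar> = \<bar>(N - 3/2) + s * (s - R)\<bar> / R" using R by simp
  also have "\<dots> \<le> (9 * (1 - l)) / (1/2)"
  proof (rule frac_le)
    have "\<bar>s * (s - R)\<bar> \<le> 2 * (2 * (1 - l))"
      unfolding abs_mult using s diff by (intro mult_mono) auto
    then show "\<bar>(N - 3/2) + s * (s - R)\<bar> \<le> 9 * (1 - l)" using N unfolding right_diff_distrib by linarith
  qed (use R l in auto)
  finally show ?thesis unfolding N_def R_def s_def P_def m_def by simp
qed

text \<open>The smaller root 1/(4 l) is at most 1/2, so its contribution decays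
  exponentially.\<close>

lemma minor_factor_estimate:
  "\<bar>2 * (1 / (4 * l)) ^ Suc j * (fourier_symbol 1 (root_param l) - l) / (l * root_weight l)\<bar> \<le> 6 * (1/2) ^ j"
proof -
  define P where "P = fourier_symbol 1 (root_param l)"
  have "\<bar>P - 1\<bar> \<le> 2 * (1 - l)" unfolding P_def by (rule fourier_symbol_1_root_param)
  then have "\<bar>P - l\<bar> \<le> 3/2" using l unfolding right_diff_distrib by linarith
  moreover have "(1 / (4 * l)) ^ Suc j \<le> (1/2) ^ Suc j"
    using inverse_root_bounds l by (intro power_mono) auto
  ultimately have "\<bar>2 * (1 / (4 * l)) ^ Suc j * (P - l)\<bar>
      \<le> 2 * (1/2) ^ Suc j * (3/2)"
    unfolding abs_mult using inverse_root_bounds l by (intro mult_mono) auto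
  moreover have "1/2 * (1/2) \<le> l * root_weight l"
    using l root_weight_ge by (intro mult_mono) auto
  ultimately have "\<bar>2 * (1 / (4 * l)) ^ Suc j * (P - l)\<bar> / \<bar>l * root_weight l\<bar>
      \<le> (2 * (1/2) ^ Suc j * (3/2)) / (1/2 * (1/2))"
    using root_weight_ge by (intro frac_le) auto
  then show ?thesis unfolding P_def by (simp only: abs_divide) simp
qed

end

section \<open>The substitution cos t = \<open>root_param\<close> (cos^2 p)\<close>

lemma cos_squared_octant:
  assumes "0 \<le> p" "p \<le> pi / 4"
  shows "1/2 \<le> (cos p)\<^sup>2"
proof -
  have "cos (pi / 4) \<le> cos p" using assms by (intro cos_monotone_0_pi_le) auto
  then have "(sqrt 2 / 2)\<^sup>2 \<le> (cos p)\<^sup>2" by (intro power_mono) (simp_all add: cos_45)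
  then show ?thesis by (simp add: power_divide)
qed

text \<open>The range 0 \<le> p \<le> pi/4 corresponds to 1 \<ge> cos t \<ge> 3/4, where the roots
  are real. In the Jacobian sin p cancels, and its factor l - 1/(4 l) is the one carried by the
  closed form, so no singularity remains.\<close>

lemma fourier_symbol_near_zero:
  "((\<lambda>p. cos p * (((cos p)\<^sup>2) ^ j *
        (2 * (fourier_symbol 1 (root_param ((cos p)\<^sup>2)) - 1 / (4 * (cos p)\<^sup>2)) / root_weight ((cos p)\<^sup>2))
      - 2 * (1 / (4 * (cos p)\<^sup>2)) ^ Suc j * (fourier_symbol 1 (root_param ((cos p)\<^sup>2)) - (cos p)\<^sup>2)
        / ((cos p)\<^sup>2 * root_weight ((cos p)\<^sup>2))))
    has_integral integral {0..arccos (3/4)} (\<lambda>t. fourier_symbol (Suc j) (cos t))) {0..pi/4}"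
proof -
  define c where "c p = root_param ((cos p)\<^sup>2)" for p :: real
  define c' where "c' p = - 2 * cos p * sin p * (1 - 1 / (4 * (cos p) ^ 4))" for p :: real
  have l: "1/2 \<le> (cos p)\<^sup>2" "(cos p)\<^sup>2 \<le> 1" if "p \<in> {0..pi/4}" for p
    using that cos_squared_octant abs_cos_le_one[of p] by (auto simp: abs_square_le_1)
  have c: "3/4 \<le> c p" "c p \<le> 1" if "p \<in> {0..pi/4}" for p
    using root_param_bounds[OF l[OF that]] by (simp_all add: c_def)
  have deriv_c: "(c has_real_derivative c' p) (at p)" if "p \<in> {0..pi/4}" for p
  proof -
    have "cos p \<noteq> 0" using l[OF that] by auto
    then show ?thesis unfolding c_def root_param_def c'_def
      by (auto intro!: derivative_eq_intros simp: field_simps power2_eq_square power4_eq_xxxx)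
  qed
  have "((\<lambda>p. (- c' p / sqrt (1 - (c p)\<^sup>2)) *\<^sub>R fourier_symbol (Suc j) (cos (arccos (c p)))) has_integral
      integral {arccos (c 0)..arccos (c (pi/4))} (\<lambda>t. fourier_symbol (Suc j) (cos t))) {0..pi/4}"
  \<comment> \<open>The exceptional set is {0}: at \<open>p = 0\<close> the argument of arccos is 1,
    where arccos has no derivative.\<close>
  proof (rule has_integral_substitution_strong[where s = "{0}" and c = 0 and d = pi])
    have ends: "c 0 = 1" "c (pi/4) = 3/4"
      by (simp_all add: c_def root_param_def cos_45 power_divide)
    show "arccos (c 0) \<le> arccos (c (pi/4))"
      unfolding ends by (intro arccos_le_arccos) auto
    show "(\<lambda>p. arccos (c p)) ` {0..pi/4} \<subseteq> {0..pi}"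
      using c by (fastforce intro!: arccos_lbound arccos_ubound)
    show "continuous_on {0..pi} (\<lambda>t. fourier_symbol (Suc j) (cos t))"
      by (rule continuous_on_compose2[OF fourier_symbol_continuous]) (auto intro!: continuous_intros)
    have "continuous_on {0..pi/4} c"
      by (rule DERIV_continuous_on) (rule has_field_derivative_at_within[OF deriv_c])
    then show "continuous_on {0..pi/4} (\<lambda>p. arccos (c p))"
      by (rule continuous_on_arccos) (use c in fastforce)
    fix p assume p: "p \<in> {0..pi/4} - {0}"
    then have "p \<in> {0..pi/4}" and "0 < p" by auto
    have "sin p > 0" using \<open>0 < p\<close> p by (intro sin_gt_zero) auto
    have lt1: "c p < 1"
    proof -
      have "0 < (sin p)\<^sup>2 * (1 - 1 / (4 * (cos p)\<^sup>2))"
        using \<open>sin p > 0\<close> inverse_root_bounds(2)[OF l[OF \<open>p \<in> {0..pi/4}\<close>]]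
        by (intro mult_pos_pos) auto
      then show ?thesis
        using one_minus_root_param[of "(cos p)\<^sup>2"] l(1)[OF \<open>p \<in> {0..pi/4}\<close>]
        unfolding c_def sin_squared_eq by linarith
    qed
    have "((\<lambda>p. arccos (c p)) has_real_derivative inverse (- sqrt (1 - (c p)\<^sup>2)) * c' p) (at p within {0..pi/4})"
      using c(1)[OF \<open>p \<in> {0..pi/4}\<close>] lt1
      by (intro DERIV_chain2[OF DERIV_arccos has_field_derivative_at_within[OF deriv_c[OF \<open>p \<in> {0..pi/4}\<close>]]]) auto
    then show "((\<lambda>p. arccos (c p)) has_real_derivative - c' p / sqrt (1 - (c p)\<^sup>2)) (at p within {0..pi/4})"
      by (simp add: field_simps)
  qed auto
  moreover have "c 0 = 1" "c (pi/4) = 3/4"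
    by (simp_all add: c_def root_param_def cos_45 power_divide)
  ultimately have "((\<lambda>p. (- c' p / sqrt (1 - (c p)\<^sup>2)) * fourier_symbol (Suc j) (cos (arccos (c p)))) has_integral
      integral {0..arccos (3/4)} (\<lambda>t. fourier_symbol (Suc j) (cos t))) {0..pi/4}"
    by simp
  then show ?thesis
  \<comment> \<open>At \<open>p = 0\<close> the Jacobian reads 0/0, so the integrands are compared
    away from this point.\<close>
  proof (rule has_integral_spike_finite[of "{0}", rotated 2])
    fix p assume p: "p \<in> {0..pi/4} - {0}"
    then have p': "p \<in> {0..pi/4}" and "0 < p" by auto
    have "sin p > 0" using \<open>0 < p\<close> p by (intro sin_gt_zero) auto
    define l' where "l' = (cos p)\<^sup>2"
    define m where "m = 1 / (4 * l')"
    define R where "R = root_weight l'"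
    define P where "P = fourier_symbol 1 (c p)"
    have l': "1/2 \<le> l'" "l' \<le> 1" using l[OF p'] by (simp_all add: l'_def)
    have cos_nz: "cos p \<noteq> 0" using l'(1) by (auto simp: l'_def)
    have lm: "l' * m = 1/4" "l' + m - 1/4 = c p"
      using cos_nz by (simp_all add: m_def c_def root_param_def l'_def)
    have R: "R > 0" using root_weight_ge[OF l'] by (simp add: R_def)
    have "1 - (c p)\<^sup>2 = (1 - c p) * (1 + c p)" by (simp add: power2_eq_square algebra_simps)
    also have "1 - c p = (sin p)\<^sup>2 * (1 - m)"
      using one_minus_root_param[of l'] l' cos_nz by (simp add: c_def l'_def m_def sin_squared_eq)
    finally have "1 - (c p)\<^sup>2 = (sin p)\<^sup>2 * ((1 - m) * (1 + c p))" by (simp only: mult.assoc)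
    then have sqrt_eq: "sqrt (1 - (c p)\<^sup>2) = sin p * R"
      using \<open>sin p > 0\<close> by (simp add: real_sqrt_mult R_def root_weight_def m_def c_def l'_def)
    have c'_eq: "- c' p = 2 * cos p * sin p * ((l' - m) / l')"
      using cos_nz by (simp add: c'_def m_def l'_def field_simps flip: power_mult power_add)
    have cosarc: "cos (arccos (c p)) = c p" using c[OF p'] by simp
    have "- c' p / sqrt (1 - (c p)\<^sup>2) * fourier_symbol (Suc j) (cos (arccos (c p)))
        = 2 * cos p / (l' * R) * ((l' - m) * fourier_symbol (Suc j) (c p))"
      unfolding sqrt_eq c'_eq cosarc using \<open>sin p > 0\<close> R l' by (simp add: field_simps)
    also have "(l' - m) * fourier_symbol (Suc j) (c p) = l' ^ Suc j * (P - m) - m ^ Suc j * (P - l')"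
      using fourier_symbol_closed_form[OF lm(1), of j] unfolding lm(2) P_def .
    also have "2 * cos p / (l' * R) * (l' ^ Suc j * (P - m) - m ^ Suc j * (P - l')) =
        cos p * (l' ^ j * (2 * (P - m) / R) - 2 * m ^ Suc j * (P - l') / (l' * R))"
      using R l' by (simp add: field_simps)
    finally show "cos p * (((cos p)\<^sup>2) ^ j *
        (2 * (fourier_symbol 1 (root_param ((cos p)\<^sup>2)) - 1 / (4 * (cos p)\<^sup>2)) / root_weight ((cos p)\<^sup>2))
      - 2 * (1 / (4 * (cos p)\<^sup>2)) ^ Suc j * (fourier_symbol 1 (root_param ((cos p)\<^sup>2)) - (cos p)\<^sup>2)
        / ((cos p)\<^sup>2 * root_weight ((cos p)\<^sup>2))) =
      - c' p / sqrt (1 - (c p)\<^sup>2) * fourier_symbol (Suc j) (cos (arccos (c p)))"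
      by (simp only: P_def R_def m_def l'_def c_def)
  qed simp
qed

section \<open>Comparison with full Wallis integrals\<close>

lemma cos_power_integrable: "(\<lambda>t. cos t ^ n) integrable_on {a..b::real}"
  by (intro integrable_continuous_real continuous_intros)

lemma wallis_integral_split:
  "wallis_integral n = integral {0..pi/4} (\<lambda>t. cos t ^ n) + integral {pi/4..pi/2} (\<lambda>t. cos t ^ n)"
  unfolding wallis_integral_def
  by (intro Henstock_Kurzweil_Integration.integral_combine[symmetric] cos_power_integrable) auto

text \<open>The substitution reaches only pi/4. Completing the Wallis integral to pi/2 is cheap
  because cos^2 t \<le> 1/2 on the added piece.\<close>

lemma cos_power_upper_octant:
  fixes j :: nat
  shows "0 \<le> integral {pi/4..pi/2} (\<lambda>t. cos t ^ n)"
    and "integral {pi/4..pi/2} (\<lambda>t. cos t ^ (2 * j + 3)) \<le> integral {pi/4..pi/2} (\<lambda>t. cos t ^ (2 * j + 1))"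
    and "integral {pi/4..pi/2} (\<lambda>t. cos t ^ (2 * j + 1)) \<le> (1/2) ^ j"
proof -
  have pos: "0 \<le> cos t" if "t \<in> {pi/4..pi/2}" for t
    using that pi_ge_zero by (intro cos_nonneg_quadrant) auto
  show "0 \<le> integral {pi/4..pi/2} (\<lambda>t. cos t ^ n)"
    by (intro integral_nonneg cos_power_integrable zero_le_power pos)
  show "integral {pi/4..pi/2} (\<lambda>t. cos t ^ (2 * j + 3)) \<le> integral {pi/4..pi/2} (\<lambda>t. cos t ^ (2 * j + 1))"
    by (intro integral_le cos_power_integrable power_decreasing pos) auto
  have "integral {pi/4..pi/2} (\<lambda>t. cos t ^ (2 * j + 1)) \<le> integral {pi/4..pi/2} (\<lambda>t. (1/2) ^ j)"
  proof (intro integral_le cos_power_integrable)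
    fix t assume t: "t \<in> {pi/4..pi/2}"
    have "cos t \<le> cos (pi / 4)" using t pi_ge_zero by (intro cos_monotone_0_pi_le) auto
    then have "(cos t)\<^sup>2 \<le> (sqrt 2 / 2)\<^sup>2" using pos[OF t] by (intro power_mono) (simp_all add: cos_45)
    then have "(cos t)\<^sup>2 \<le> 1/2" by (simp add: power_divide)
    then have "((cos t)\<^sup>2) ^ j \<le> (1/2) ^ j" by (intro power_mono) auto
    moreover have "cos t ^ (2 * j + 1) \<le> cos t ^ (2 * j)"
      by (intro power_decreasing pos[OF t]) auto
    ultimately show "cos t ^ (2 * j + 1) \<le> (1/2) ^ j" by (simp add: power_mult)
  qed auto
  also have "\<dots> = pi / 4 * (1/2) ^ j" by simp
  also have "\<dots> \<le> 1 * (1/2) ^ j" using pi_less_4 by (intro mult_right_mono) auto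
  finally show "integral {pi/4..pi/2} (\<lambda>t. cos t ^ (2 * j + 1)) \<le> (1/2) ^ j" by simp
qed

text \<open>The main factor is frozen at its value for p = 0. The Lipschitz error carries 1 - cos^2
  p, which gains a factor 1/(2j + 3); of the exponential term, 6 comes from the smaller root and 2
  from the added octant.\<close>

lemma near_zero_estimate:
  "\<bar>integral {0..arccos (3/4)} (\<lambda>t. fourier_symbol (Suc j) (cos t)) - sqrt (3/2) * wallis_integral (2 * j + 1)\<bar>
     \<le> 18 * wallis_integral (2 * j + 1) / (2 * real j + 3) + 8 * (1/2) ^ j"
proof -
  define s where "s = sqrt (3/2)"
  define V where "V = integral {0..arccos (3/4)} (\<lambda>t. fourier_symbol (Suc j) (cos t))"
  define W where "W n = wallis_integral n" for n
  define Q where "Q n = integral {0..pi/4} (\<lambda>t. cos t ^ n)" for n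
  define U where "U n = integral {pi/4..pi/2} (\<lambda>t. cos t ^ n)" for n
  define A where "A p = 2 * (fourier_symbol 1 (root_param ((cos p)\<^sup>2)) - 1 / (4 * (cos p)\<^sup>2))
    / root_weight ((cos p)\<^sup>2)" for p :: real
  define B where "B p = 2 * (1 / (4 * (cos p)\<^sup>2)) ^ Suc j
    * (fourier_symbol 1 (root_param ((cos p)\<^sup>2)) - (cos p)\<^sup>2) / ((cos p)\<^sup>2 * root_weight ((cos p)\<^sup>2))"
    for p :: real
  have s: "0 \<le> s" "s \<le> 2" by (auto simp: s_def intro!: real_le_lsqrt)
  have Q: "((\<lambda>t. cos t ^ n) has_integral Q n) {0..pi/4}" for n
    unfolding Q_def by (intro integrable_integral cos_power_integrable)
  have f: "((\<lambda>p. cos p * (((cos p)\<^sup>2) ^ j * A p - B p)) has_integral V) {0..pi/4}"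
    using fourier_symbol_near_zero[of j] unfolding A_def B_def V_def .
  have f_diff: "((\<lambda>p. cos p * (((cos p)\<^sup>2) ^ j * A p - B p) - s * cos p ^ (2 * j + 1)) has_integral
      (V - s * Q (2 * j + 1))) {0..pi/4}"
    by (intro has_integral_diff f has_integral_mult_right Q)
  have "((\<lambda>p. 6 * (1/2::real) ^ j) has_integral (6 * (1/2) ^ j * (pi/4))) {0..pi/4}"
    using has_integral_const_real[of "6 * (1/2::real) ^ j" 0 "pi/4"] by (simp add: mult.commute)
  then have g: "((\<lambda>p. 18 * (cos p ^ (2 * j + 1) - cos p ^ (2 * j + 3)) + 6 * (1/2) ^ j) has_integral
      (18 * (Q (2 * j + 1) - Q (2 * j + 3)) + 6 * (1/2) ^ j * (pi/4))) {0..pi/4}"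
    by (intro has_integral_add has_integral_diff has_integral_mult_right Q)
  have bound: "norm (cos p * (((cos p)\<^sup>2) ^ j * A p - B p) - s * cos p ^ (2 * j + 1))
      \<le> 18 * (cos p ^ (2 * j + 1) - cos p ^ (2 * j + 3)) + 6 * (1/2) ^ j"
    if p: "p \<in> {0..pi/4}" for p
  proof -
    have c0: "0 \<le> cos p" using p pi_ge_zero by (intro cos_nonneg_quadrant) auto
    have l: "1/2 \<le> (cos p)\<^sup>2" "(cos p)\<^sup>2 \<le> 1"
      using p cos_squared_octant abs_cos_le_one[of p] by (auto simp: abs_square_le_1)
    have A: "\<bar>A p - s\<bar> \<le> 18 * (1 - (cos p)\<^sup>2)"
      unfolding A_def s_def by (rule main_factor_estimate[OF l])
    have B: "\<bar>B p\<bar> \<le> 6 * (1/2) ^ j"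
      unfolding B_def by (rule minor_factor_estimate[OF l])
    have "cos p * (((cos p)\<^sup>2) ^ j * A p - B p) - s * cos p ^ (2 * j + 1)
        = cos p ^ (2 * j + 1) * (A p - s) - cos p * B p"
      unfolding power_add power_mult power_one_right by algebra
    moreover have "\<bar>cos p ^ (2 * j + 1) * (A p - s)\<bar> \<le> cos p ^ (2 * j + 1) * (18 * (1 - (cos p)\<^sup>2))"
      unfolding abs_mult using c0 A by (intro mult_mono) (simp_all add: abs_mult)
    moreover have "cos p ^ (2 * j + 1) * (18 * (1 - (cos p)\<^sup>2))
        = 18 * (cos p ^ (2 * j + 1) - cos p ^ (2 * j + 3))"
      by (simp add: power_add power2_eq_square power3_eq_cube algebra_simps)
    moreover have "\<bar>cos p * B p\<bar> \<le> 1 * (6 * (1/2) ^ j)"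
      unfolding abs_mult using abs_cos_le_one[of p] B by (intro mult_mono) auto
    ultimately show ?thesis unfolding real_norm_def by linarith
  qed
  have main: "\<bar>V - s * Q (2 * j + 1)\<bar> \<le> 18 * (Q (2 * j + 1) - Q (2 * j + 3)) + 6 * (1/2) ^ j * (pi/4)"
    using has_integral_norm_bound_integral_component[OF f_diff g, of 1] bound by simp
  have split: "W n = Q n + U n" for n
    unfolding W_def Q_def U_def by (rule wallis_integral_split)
  have U: "0 \<le> U (2 * j + 1)" "U (2 * j + 3) \<le> U (2 * j + 1)" "U (2 * j + 1) \<le> (1/2) ^ j"
    unfolding U_def by (rule cos_power_upper_octant)+
  have "(2 * real j + 3) * (W (2 * j + 1) - W (2 * j + 3)) = W (2 * j + 1)"
    using wallis_integral_rec[of "2 * j + 1"] by (simp add: W_def numeral_3_eq_3 algebra_simps)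
  then have "W (2 * j + 1) - W (2 * j + 3) = W (2 * j + 1) / (2 * real j + 3)"
    by (simp add: eq_divide_eq mult.commute)
  \<comment> \<open>The upper octant contributes a nonnegative amount to the difference, so dropping
    it preserves the bound.\<close>
  then have W: "Q (2 * j + 1) - Q (2 * j + 3) \<le> W (2 * j + 1) / (2 * real j + 3)"
    using split[of "2 * j + 1"] split[of "2 * j + 3"] U by linarith
  have "s * U (2 * j + 1) \<le> 2 * (1/2) ^ j" "0 \<le> s * U (2 * j + 1)"
    using s U by (auto intro!: mult_mono)
  moreover have "6 * (1/2) ^ j * (pi/4) \<le> 6 * (1/2) ^ j * (1::real)"
    using pi_less_4 by (intro mult_left_mono) auto
  moreover have "s * W (2 * j + 1) = s * Q (2 * j + 1) + s * U (2 * j + 1)"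
    unfolding split by (rule distrib_left)
  moreover have "18 * W (2 * j + 1) / (2 * real j + 3) = 18 * (W (2 * j + 1) / (2 * real j + 3))" by simp
  ultimately have "\<bar>V - s * W (2 * j + 1)\<bar> \<le> 18 * W (2 * j + 1) / (2 * real j + 3) + 8 * (1/2) ^ j"
    using main W unfolding right_diff_distrib by linarith
  then show ?thesis unfolding V_def s_def W_def .
qed

text \<open>Here cos t \<le> 3/4, the range of the exponential bound on the symbol; 4 bounds the
  length of the interval.\<close>

lemma away_from_zero_estimate:
  "\<bar>integral {arccos (3/4)..pi} (\<lambda>t. fourier_symbol j (cos t))\<bar> \<le> 4 * (5 * real j + 1) / 2 ^ j"
proof -
  have range: "0 \<le> arccos (3/4)" "arccos (3/4) \<le> pi" by (auto intro: arccos_lbound arccos_ubound)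
  have "norm (integral {arccos (3/4)..pi} (\<lambda>t. fourier_symbol j (cos t)))
      \<le> (5 * real j + 1) / 2 ^ j * (pi - arccos (3/4))"
  proof (rule integral_bound[OF range(2)])
    show "continuous_on {arccos (3/4)..pi} (\<lambda>t. fourier_symbol j (cos t))"
      by (rule continuous_on_compose2[OF fourier_symbol_continuous]) (auto intro!: continuous_intros)
    fix t assume t: "t \<in> {arccos (3/4)..pi}"
    then have "cos t \<le> cos (arccos (3/4))" using range by (intro cos_monotone_0_pi_le) auto
    then have "cos t \<le> 3/4" by simp
    then show "norm (fourier_symbol j (cos t)) \<le> (5 * real j + 1) / 2 ^ j"
      using fourier_symbol_tail_bound[of "cos t" j] by simp
  qed
  also have "\<dots> \<le> (5 * real j + 1) / 2 ^ j * 4"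
    using range pi_less_4 by (intro mult_left_mono) auto
  finally show ?thesis by simp
qed

text \<open>The square lies between pi/(4 (j + 1)) and pi/(2 (2j + 1)). These differ by order
  j^(-2), and dividing by a square root of order j^(-1/2) gives order j^(-3/2).\<close>

lemma wallis_integral_odd_estimate:
  "\<bar>wallis_integral (2 * j + 1) - sqrt (pi / (4 * (real j + 1)))\<bar>
     \<le> (pi / (2 * (2 * real j + 1)) - pi / (4 * (real j + 1))) / sqrt (pi / (4 * (real j + 1)))"
proof -
  define W where "W = wallis_integral (2 * j + 1)"
  define a where "a = sqrt (pi / (4 * (real j + 1)))"
  have a: "a > 0" "a\<^sup>2 = pi / (4 * (real j + 1))" by (simp_all add: a_def)
  have up: "W\<^sup>2 \<le> pi / (2 * (2 * real j + 1))"
    using wallis_integral_square_le[of "2 * j"] by (simp add: W_def add.commute)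
  have "a\<^sup>2 \<le> W\<^sup>2"
    using wallis_integral_square_ge[of "2 * j + 1"] unfolding a(2) by (simp add: W_def algebra_simps)
  moreover have "0 \<le> W" unfolding W_def by (rule wallis_integral_nonneg)
  ultimately have "a \<le> W" by (rule power2_le_imp_le)
  then have "(W - a) * a \<le> (W - a) * (W + a)"
    using a \<open>0 \<le> W\<close> by (intro mult_left_mono) auto
  also have "\<dots> = W\<^sup>2 - a\<^sup>2" by algebra
  also have "\<dots> \<le> pi / (2 * (2 * real j + 1)) - pi / (4 * (real j + 1))"
    using up unfolding a(2) by linarith
  finally have "W - a \<le> (pi / (2 * (2 * real j + 1)) - pi / (4 * (real j + 1))) / a"
    by (simp only: pos_le_divide_eq[OF a(1)])
  moreover have "\<bar>W - a\<bar> = W - a" using \<open>a \<le> W\<close> by simp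
  ultimately show ?thesis unfolding W_def a_def by simp
qed

lemma leading_term_eq:
  assumes "n \<ge> 1"
  shows "2 * pi * (sqrt 3 / (4 * sqrt (2 * pi * real n))) = sqrt (3/2) * sqrt (pi / (4 * real n))"
proof -
  have "sqrt pi * sqrt pi = pi" by simp
  then have "pi / sqrt pi = sqrt pi" by (simp add: real_div_sqrt)
  have "2 * pi * (sqrt 3 / (4 * sqrt (2 * pi * real n))) = sqrt 3 * (pi / sqrt pi) / (2 * sqrt 2 * sqrt (real n))"
    by (simp add: real_sqrt_mult mult_ac)
  also have "\<dots> = sqrt (3/2) * sqrt (pi / (4 * real n))"
    unfolding \<open>pi / sqrt pi = sqrt pi\<close> by (simp add: real_sqrt_mult real_sqrt_divide)
  finally show ?thesis .
qed

text \<open>The four summands bound, in order, the Wallis approximation, the Lipschitz error, the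
  exponential error near zero and the tail of the integral. The bound holds for 2 pi times the
  deviation, hence for the deviation.\<close>

lemma cdens_tj_estimate:
  assumes "n \<ge> 1"
  shows "\<bar>cdens (tj n) - (1/2 + sqrt 3 / (4 * sqrt (2 * pi * real n)))\<bar> \<le>
    2 * ((pi / (2 * (2 * real n - 1)) - pi / (4 * real n)) / sqrt (pi / (4 * real n)))
    + 18 * sqrt (pi / (2 * (2 * real n - 1))) / (2 * real n + 1)
    + 16 / 2 ^ n + 4 * (5 * real n + 1) / 2 ^ n"
proof -
  obtain j where n: "n = Suc j" using assms by (cases n) auto
  define s where "s = sqrt (3/2)"
  define D where "D = cdens (tj n) - (1/2 + sqrt 3 / (4 * sqrt (2 * pi * real n)))"
  define V where "V = integral {0..arccos (3/4)} (\<lambda>t. fourier_symbol n (cos t))"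
  define T where "T = integral {arccos (3/4)..pi} (\<lambda>t. fourier_symbol n (cos t))"
  define W where "W = wallis_integral (2 * j + 1)"
  define a where "a = sqrt (pi / (4 * real n))"
  define e where "e = (pi / (2 * (2 * real n - 1)) - pi / (4 * real n)) / a"
  define b where "b = sqrt (pi / (2 * (2 * real n - 1)))"
  have s: "0 \<le> s" "s \<le> 2" by (auto simp: s_def intro!: real_le_lsqrt)
  have jn: "real j + 1 = real n" "2 * real j + 1 = 2 * real n - 1" "2 * real j + 3 = 2 * real n + 1"
    by (simp_all add: n)
  have "V + T = integral {0..pi} (\<lambda>t. fourier_symbol n (cos t))"
    unfolding V_def T_def
    using cdens_tj_integral[of n]
    by (intro Henstock_Kurzweil_Integration.integral_combine)
      (auto intro: arccos_lbound arccos_ubound simp: has_integral_iff)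
  then have total: "2 * pi * (cdens (tj n) - 1/2) = V + T"
    using cdens_tj_integral[of n] by (simp add: integral_unique)
  have W: "\<bar>W - a\<bar> \<le> e"
    using wallis_integral_odd_estimate[of j] unfolding jn W_def e_def a_def .
  have "W\<^sup>2 \<le> pi / (2 * (2 * real n - 1))"
    using wallis_integral_square_le[of "2 * j"] unfolding jn(2)[symmetric] by (simp add: W_def add.commute)
  then have W_le: "W \<le> b" unfolding b_def by (rule real_le_rsqrt)
  have V: "\<bar>V - s * W\<bar> \<le> 18 * W / (2 * real n + 1) + 8 * (1/2) ^ j"
    using near_zero_estimate[of j] unfolding jn V_def W_def s_def n .
  have "18 * W / (2 * real n + 1) \<le> 18 * b / (2 * real n + 1)"
    using W_le by (intro divide_right_mono) auto
  moreover have "8 * (1/2::real) ^ j = 16 / 2 ^ n" by (simp add: n power_divide)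
  moreover have "\<bar>T\<bar> \<le> 4 * (5 * real n + 1) / 2 ^ n" unfolding T_def by (rule away_from_zero_estimate)
  moreover have "\<bar>s * (W - a)\<bar> \<le> 2 * e"
    unfolding abs_mult using s W by (intro mult_mono) auto
  moreover have "2 * pi * D = (V - s * W) + T + s * (W - a)"
  proof -
    have "2 * pi * D = 2 * pi * (cdens (tj n) - 1/2) - 2 * pi * (sqrt 3 / (4 * sqrt (2 * pi * real n)))"
      unfolding D_def by (simp add: algebra_simps)
    also have "\<dots> = V + T - s * a"
      unfolding total leading_term_eq[OF assms] s_def a_def ..
    finally show ?thesis by (simp add: algebra_simps)
  qed
  ultimately have "\<bar>2 * pi * D\<bar> \<le> 2 * e + 18 * b / (2 * real n + 1) + 16 / 2 ^ n + 4 * (5 * real n + 1) / 2 ^ n"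
    using V by linarith
  moreover have "\<bar>D\<bar> \<le> \<bar>2 * pi * D\<bar>"
    unfolding abs_mult using pi_gt3 by (simp add: mult_le_cancel_right1)
  ultimately show ?thesis unfolding D_def e_def a_def b_def by linarith
qed

theorem theorem1p2:
  shows "(\<lambda>j. cdens (tj j) - (1/2 + sqrt 3 / (4 * sqrt (2 * pi * real j))))
           \<in> O(\<lambda>j. real j powr (-3/2))
         \<and> (\<forall>j\<ge>1. cdens (tj j) > 1/2)"
proof
  define G :: "nat \<Rightarrow> real" where "G n =
    2 * ((pi / (2 * (2 * real n - 1)) - pi / (4 * real n)) / sqrt (pi / (4 * real n)))
    + 18 * sqrt (pi / (2 * (2 * real n - 1))) / (2 * real n + 1)
    + 16 / 2 ^ n + 4 * (5 * real n + 1) / 2 ^ n" for n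
  have "(\<lambda>j. cdens (tj j) - (1/2 + sqrt 3 / (4 * sqrt (2 * pi * real j)))) \<in> O(G)"
  proof (rule bigoI[where c = 1])
    show "\<forall>\<^sub>F n in sequentially.
        norm (cdens (tj n) - (1/2 + sqrt 3 / (4 * sqrt (2 * pi * real n)))) \<le> 1 * norm (G n)"
      using eventually_ge_at_top[of 1]
    proof eventually_elim
      case (elim n)
      show ?case 
        using cdens_tj_estimate[OF elim, folded G_def] abs_ge_self[of "G n"]
        unfolding real_norm_def mult_1 by (rule order_trans)
    qed
  qed
  \<comment> \<open>The first two summands of \<open>G\<close> have order n^(-3/2); the others decay
    exponentially.\<close>
  also have "G \<in> O(\<lambda>j. real j powr (-3/2))"
    unfolding G_def by real_asymp
  finally show "(\<lambda>j. cdens (tj j) - (1/2 + sqrt 3 / (4 * sqrt (2 * pi * real j))))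
      \<in> O(\<lambda>j. real j powr (-3/2))" .
  show "\<forall>j\<ge>1. cdens (tj j) > 1/2" using cdens_tj_gt_half by blast
qed

end
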